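(* Let $\tau:\mathcal{W}^*\to\mathcal{S}^*$ be the word-to-subword map of an end-of-word-marking tokeniser. For a word sequence $\mathbf{w}\in\mathcal{W}^*$ write $\mathbf{s}^{\mathbf{w}}:=\tau(\mathbf{w})$, and for a word $w\in\mathcal{W}$ write $\mathbf{s}^{w}:=\tau_1(w)$ (the image under $\tau$ of the one-word sequence $w$), with entries $s^{w}_{t'}$ and prefixes $\mathbf{s}^{w}_{<t'}$. Then for a word sequence $\mathbf{w}_{<t}\in\mathcal{W}^*$ and a word $w\in\mathcal{W}$: $$\mathbb{P}_{\mathcal{W}}(\mathbf{w}_{<t}\circ\mathcal{W}^* )=\mathbb{P}_{\mathcal{S}}(\mathbf{s}^{\mathbf{w}_{<t}}\circ\mathcal{S}^* ),$$ $$\mathbb{P}_{\mathcal{W}}(\mathbf{w}_{<t}\circ w\circ\mathcal{W}^* )=\mathbb{P}_{\mathcal{S}}(\mathbf{s}^{\mathbf{w}_{<t}}\circ\mathbf{s}^{w}\circ\mathcal{S}^* ).$$ Further, a word's contextual probability can be computed as $$p(w\mid\mathbf{w}_{<t})=\prod_{t'=1}^{|\mathbf{s}^{w}|}p\left(s^{w}_{t'}\mid\mathbf{s}^{\mathbf{w}_{<t}}\circ\mathbf{s}^{w}_{<t'}\right).$$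
   Context: Sequences. $\mathcal{W}$ (the lexicon) is a possibly infinite set whose elements are words; $\mathcal{C}$ (the alphabet) is a set of characters; $\mathcal{S}$ (the vocabulary) is a set whose elements are subwords. $X^*$ denotes the set of all finite sequences over $X$ (including the empty one), $|\cdot|$ denotes length, and $\circ$ denotes concatenation of sequences, extended elementwise to sets, e.g. $\mathbf{w}\circ\mathcal{W}^*=\{\mathbf{w}\circ\mathbf{w}'\mid\mathbf{w}'\in\mathcal{W}^*\}$. For a sequence $\mathbf{x}=x_1x_2\cdots$, $\mathbf{x}_{<t}=x_1\cdots x_{t-1}$. Tokeniser. There are maps $\mathcal{W}^*\to\mathcal{C}^*$ (orthography) and $\mathcal{C}^*\to\mathcal{W}^*$ (segmentation of characters into words). A tokeniser consists of a vocabulary $\mathcal{S}$, a detokenisation function $\mathcal{S}^*\to\mathcal{C}^*$ and a (deterministic) tokenisation function $\mathcal{C}^*\to\mathcal{S}^*$. The word-to-subword map $\tau:\mathcal{W}^*\to\mathcal{S}^*$ is the composition $\mathcal{W}^*\to\mathcal{C}^*\to\mathcal{S}^*$, and the subword-to-word map $\delta:\mathcal{S}^*\to\mathcal{W}^*$ is the composition $\mathcal{S}^*\to\mathcal{C}^*\to\mathcal{W}^*$. It is assumed throughout that $\delta(\tau(\mathbf{w}))=\mathbf{w}$ for all $\mathbf{w}\in\mathcal{W}^*$ (so $\tau$ is injective); $\tau(\delta(\mathbf{s}))=\mathbf{s}$ need not hold, and $\tau$ need not be surjective. Segmentation-compatible tokeniser: there is a word-level map $\tau_1:\mathcal{W}\to\mathcal{S}^*$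 with $\tau(\mathbf{w})=\tau_1(w_1)\circ\tau_1(w_2)\circ\cdots\circ\tau_1(w_{|\mathbf{w}|})$ for all $\mathbf{w}\in\mathcal{W}^*$. End-of-word-marking tokeniser: a segmentation-compatible tokeniser together with a subset $\mathcal{S}_{\mathrm{eow}}\subseteq\mathcal{S}$, with $\mathcal{S}_{\mathrm{mid}}:=\mathcal{S}\setminus\mathcal{S}_{\mathrm{eow}}$, such that $\tau_1(w)\in\mathcal{S}_{\mathrm{mid}}^*\circ\mathcal{S}_{\mathrm{eow}}$ for every $w\in\mathcal{W}$. Probabilities. $p$ is a probability distribution (mass function) on $\mathcal{W}^*$. It induces a distribution on $\mathcal{S}^*$, also denoted $p$, by $p(\mathbf{s})=\sum_{\mathbf{w}\in\mathcal{W}^*}p(\mathbf{w})\,\mathbf{1}\{\mathbf{s}=\tau(\mathbf{w})\}$. For $\Psi\subseteq\mathcal{W}^*$ put $\mathbb{P}_{\mathcal{W}}(\Psi)=\sum_{\mathbf{w}\in\Psi}p(\mathbf{w})$, and for $\Psi\subseteq\mathcal{S}^*$ put $\mathbb{P}_{\mathcal{S}}(\Psi)=\sum_{\mathbf{s}\in\Psi}p(\mathbf{s})$. Conditional probabilities are the quotients (defined when the denominator is nonzero) $$p(w\mid\mathbf{w}_{<t})=\frac{\mathbb{P}_{\mathcal{W}}(\mathbf{w}_{<t}\circ w\circ\mathcal{W}^* )}{\mathbb{P}_{\mathcal{W}}(\mathbf{w}_{<t}\circ\mathcal{W}^* )},\qquad p(s\mid\mathbf{s}')=\frac{\mathbb{P}_{\mathcal{S}}(\mathbf{s}'\circ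 s\circ\mathcal{S}^* )}{\mathbb{P}_{\mathcal{S}}(\mathbf{s}'\circ\mathcal{S}^* )}$$ for $w\in\mathcal{W}$, $\mathbf{w}_{<t}\in\mathcal{W}^*$, $s\in\mathcal{S}$, $\mathbf{s}'\in\mathcal{S}^*$. *)

theory Defs
  imports "HOL-Probability.Probability"
begin

text \<open>
  The lexicon, alphabet and vocabulary are carrier sets \<open>W\<close>, \<open>C\<close>, \<open>S\<close>; the finite sequences over a
  carrier \<open>X\<close> are \<^term>\<open>lists X\<close>. All maps are constrained on these carriers only.
\<close>

locale tokeniser =
  fixes W :: "'w set" and C :: "'c set" and S :: "'s set"
    and orth :: "'w list \<Rightarrow> 'c list" and seg :: "'c list \<Rightarrow> 'w list"
    and tok :: "'c list \<Rightarrow> 's list" and detok :: "'s list \<Rightarrow> 'c list"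
    and \<tau> :: "'w list \<Rightarrow> 's list" and \<delta> :: "'s list \<Rightarrow> 'w list"
  assumes orth_closed: "orth \<in> lists W \<rightarrow> lists C"
    and seg_closed: "seg \<in> lists C \<rightarrow> lists W"
    and tok_closed: "tok \<in> lists C \<rightarrow> lists S"
    and detok_closed: "detok \<in> lists S \<rightarrow> lists C"
    and tau_eq: "\<And>ws. ws \<in> lists W \<Longrightarrow> \<tau> ws = tok (orth ws)"
    and delta_eq: "\<And>ss. ss \<in> lists S \<Longrightarrow> \<delta> ss = seg (detok ss)"
    and delta_tau: "\<And>ws. ws \<in> lists W \<Longrightarrow> \<delta> (\<tau> ws) = ws"

locale segmentation_compatible_tokeniser = tokeniser W C S orth seg tok detok \<tau> \<delta>
  for W :: "'w set" and C :: "'c set" and S :: "'s set"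
    and orth seg tok detok \<tau> \<delta> +
  fixes \<tau>\<^sub>1 :: "'w \<Rightarrow> 's list"
  assumes tau1_closed: "\<tau>\<^sub>1 \<in> W \<rightarrow> lists S"
    and tau_concat: "\<And>ws. ws \<in> lists W \<Longrightarrow> \<tau> ws = concat (map \<tau>\<^sub>1 ws)"

locale eow_marking_tokeniser =
  segmentation_compatible_tokeniser W C S orth seg tok detok \<tau> \<delta> \<tau>\<^sub>1
  for W :: "'w set" and C :: "'c set" and S :: "'s set"
    and orth seg tok detok \<tau> \<delta> \<tau>\<^sub>1 +
  fixes S_eow :: "'s set"
  assumes eow_subset: "S_eow \<subseteq> S"
    and tau1_eow:
      "\<And>w. w \<in> W \<Longrightarrow> \<tau>\<^sub>1 w \<in> {m @ [e] | m e. m \<in> lists (S - S_eow) \<and> e \<in> S_eow}"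

text \<open>The set \<open>x \<circ> X\<^sup>*\<close> of all finite sequences over \<open>X\<close> that start with \<open>x\<close>:\<close>

definition extensions :: "'a set \<Rightarrow> 'a list \<Rightarrow> 'a list set" where
  "extensions X x = {x @ y | y. y \<in> lists X}"

definition seq_prob :: "('a list \<Rightarrow> real) \<Rightarrow> 'a list set \<Rightarrow> real" where
  "seq_prob q \<Psi> = (\<Sum>\<^sub>\<infinity>x\<in>\<Psi>. q x)"

text \<open>The quotient takes the value \<open>0\<close> when its denominator is \<open>0\<close>.\<close>

definition seq_cond_prob :: "'a set \<Rightarrow> ('a list \<Rightarrow> real) \<Rightarrow> 'a \<Rightarrow> 'a list \<Rightarrow> real" where
  "seq_cond_prob X q a x =
     seq_prob q (extensions X (x @ [a])) / seq_prob q (extensions X x)"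

definition induced_mass ::
  "'w set \<Rightarrow> ('w list \<Rightarrow> 's list) \<Rightarrow> ('w list \<Rightarrow> real) \<Rightarrow> 's list \<Rightarrow> real" where
  "induced_mass W \<tau> q s = (\<Sum>\<^sub>\<infinity>ws\<in>lists W. q ws * of_bool (s = \<tau> ws))"

end

theory Submission
  imports Defs "HOL-Library.Sublist"
begin

text \<open>
  Every \<open>\<tau>\<^sub>1 w\<close> contains exactly one end-of-word symbol, its last one, so the words of a sequence can be
  read off any string that starts with its encoding. Hence \<open>\<tau>\<close> reflects the prefix order, and the
  cylinder over \<open>\<tau> ws\<close> meets the image of \<open>\<tau>\<close> exactly in the image of the cylinder over \<open>ws\<close>. The
  chain of conditional probabilities then telescopes.
\<close>

lemma mem_extensions_iff:
  assumes "x \<in> lists X"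
  shows "y \<in> extensions X x \<longleftrightarrow> y \<in> lists X \<and> prefix x y"
  using assms by (auto simp: extensions_def prefix_def)

lemma extensions_append_subset:
  assumes "y \<in> lists X"
  shows "extensions X (x @ y) \<subseteq> extensions X x"
  using assms by (fastforce simp: extensions_def)

text \<open>The first entry belonging to \<open>E\<close> sits at a position determined by the
  string alone, so both decompositions cut there, whatever the tails \<open>x\<close> and
  \<open>y\<close> are.\<close>

lemma append_Cons_eq_first_marker:
  assumes "m @ e # x = m' @ e' # y" "e \<in> E" "e' \<in> E" "set m \<inter> E = {}" "set m' \<inter> E = {}"
  shows "m = m' \<and> e = e'"
  using assms
proof (induction m arbitrary: m')
  case Nil
  then show ?case by (cases m') auto
next
  case (Cons a m)
  then show ?case by (cases m') auto
qed

lemma summable_on_pmf: "pmf p summable_on A"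
  using pmf_abs_summable[of p A] unfolding abs_summable_equivalent[symmetric] by (rule abs_summable_summable)

text \<open>If \<open>f\<close> vanishes at some stage it vanishes from there on, so the convention \<open>x / 0 = 0\<close> is harmless.\<close>

lemma prod_quotients_telescope:
  fixes f :: "nat \<Rightarrow> 'a::field"
  assumes "f 0 \<noteq> 0" and "\<And>t. t < n \<Longrightarrow> f t = 0 \<Longrightarrow> f (Suc t) = 0"
  shows "(\<Prod>t<n. f (Suc t) / f t) = f n / f 0"
  using assms(2) by (induction n) (auto simp: assms(1))

text \<open>\<open>induced_mass\<close> is the pushforward of \<open>q\<close> along
  \<open>\<tau>\<close>. Injectivity leaves at most one nonzero term in the sum defining it, so a
  sum over \<open>\<Psi>\<close> lives on the points of the image and can be reindexed by their
  preimages.\<close>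

lemma seq_prob_induced_mass:
  assumes "inj_on \<tau> (lists W)"
  shows "seq_prob (induced_mass W \<tau> q) \<Psi> = seq_prob q {vs \<in> lists W. \<tau> vs \<in> \<Psi>}"
proof -
  let ?V = "{vs \<in> lists W. \<tau> vs \<in> \<Psi>}"
  have image: "induced_mass W \<tau> q (\<tau> vs) = q vs" if "vs \<in> lists W" for vs
  proof -
    have "induced_mass W \<tau> q (\<tau> vs) = (\<Sum>\<^sub>\<infinity>us\<in>{vs}. q us)"
      unfolding induced_mass_def using that assms
      by (intro infsum_cong_neutral) (auto dest: inj_onD)
    then show ?thesis by simp
  qed
  have outside: "induced_mass W \<tau> q s = 0" if "s \<in> \<Psi> - \<tau> ` ?V" for s
    unfolding induced_mass_def using that by (intro infsum_0) auto
  have "(\<Sum>\<^sub>\<infinity>s\<in>\<Psi>. induced_mass W \<tau> q s) = (\<Sum>\<^sub>\<infinity>s\<in>\<tau> ` ?V. induced_mass W \<tau> q s)"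
    by (rule infsum_cong_neutral) (blast intro: outside)+
  also have "\<dots> = (\<Sum>\<^sub>\<infinity>vs\<in>?V. (induced_mass W \<tau> q \<circ> \<tau>) vs)"
    by (rule infsum_reindex) (rule inj_on_subset[OF assms], auto)
  also have "\<dots> = (\<Sum>\<^sub>\<infinity>vs\<in>?V. q vs)"
    using image by (intro infsum_cong) auto
  finally show ?thesis by (simp add: seq_prob_def)
qed

text \<open>Pulling back to word sequences turns both sums into sums of a \<open>pmf\<close>, where
  summability and nonnegativity give monotonicity. This supplies the vanishing condition of
  \<open>prod_quotients_telescope\<close>.\<close>

lemma seq_prob_induced_mass_eq_0_mono:
  assumes "inj_on \<tau> (lists W)" and "\<Psi> \<subseteq> \<Phi>"
    and "seq_prob (induced_mass W \<tau> (pmf p)) \<Phi> = 0"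
  shows "seq_prob (induced_mass W \<tau> (pmf p)) \<Psi> = 0"
proof -
  have "seq_prob (pmf p) {vs \<in> lists W. \<tau> vs \<in> \<Psi>} \<le> seq_prob (pmf p) {vs \<in> lists W. \<tau> vs \<in> \<Phi>}"
    unfolding seq_prob_def using assms(2)
    by (intro infsum_mono2 summable_on_pmf) auto
  moreover have "seq_prob (pmf p) {vs \<in> lists W. \<tau> vs \<in> \<Psi>} \<ge> 0"
    unfolding seq_prob_def by (intro infsum_nonneg) auto
  ultimately show ?thesis
    using assms(3) by (simp add: seq_prob_induced_mass[OF assms(1)])
qed

context tokeniser
begin

lemma inj_on_tau: "inj_on \<tau> (lists W)"
  by (rule inj_on_inverseI) (rule delta_tau)

lemma tau_in_lists:
  assumes "ws \<in> lists W"
  shows "\<tau> ws \<in> lists S"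
  using assms orth_closed tok_closed tau_eq by (metis PiE)

end

context segmentation_compatible_tokeniser
begin

lemma tau_singleton:
  assumes "w \<in> W"
  shows "\<tau> [w] = \<tau>\<^sub>1 w"
  using assms tau_concat[of "[w]"] by simp

lemma tau_append:
  assumes "us \<in> lists W" "vs \<in> lists W"
  shows "\<tau> (us @ vs) = \<tau> us @ \<tau> vs"
  using assms tau_concat by simp

lemma tau_Cons:
  assumes "w \<in> W" "ws \<in> lists W"
  shows "\<tau> (w # ws) = \<tau>\<^sub>1 w @ \<tau> ws"
  using assms tau_append[of "[w]" ws] tau_singleton by simp

lemma tau_Nil: "\<tau> [] = []"
  using tau_concat[of "[]"] by simp

lemma inj_on_tau1: "inj_on \<tau>\<^sub>1 W"
proof (rule inj_onI)
  fix a b assume "a \<in> W" "b \<in> W" "\<tau>\<^sub>1 a = \<tau>\<^sub>1 b"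
  then show "a = b"
    using inj_onD[OF inj_on_tau, of "[a]" "[b]"] by (simp add: tau_singleton)
qed

end

context eow_marking_tokeniser
begin

text \<open>Unique decoding of the leading word: the first symbol from \<open>S_eow\<close> in the
  common string ends both codes, so the codes coincide, and \<open>\<tau>\<^sub>1\<close> is
  injective.\<close>

lemma tau1_append_cancel:
  assumes "a \<in> W" "b \<in> W" "\<tau>\<^sub>1 a @ x = \<tau>\<^sub>1 b @ y"
  shows "a = b"
proof -
  obtain m e where a: "\<tau>\<^sub>1 a = m @ [e]" "m \<in> lists (S - S_eow)" "e \<in> S_eow"
    using tau1_eow[OF assms(1)] by auto
  obtain m' e' where b: "\<tau>\<^sub>1 b = m' @ [e']" "m' \<in> lists (S - S_eow)" "e' \<in> S_eow"
    using tau1_eow[OF assms(2)] by auto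
  have "m = m' \<and> e = e'"
    using assms(3) a b by (intro append_Cons_eq_first_marker[where E = S_eow]) auto
  then show ?thesis
    using a b assms inj_onD[OF inj_on_tau1] by simp
qed

text \<open>The direction from codes to words decodes one word at a time: the leading words agree by
  \<open>tau1_append_cancel\<close>, and their common code cancels.\<close>

lemma prefix_tau_iff:
  assumes "us \<in> lists W" "vs \<in> lists W"
  shows "prefix (\<tau> us) (\<tau> vs) \<longleftrightarrow> prefix us vs"
proof
  assume "prefix us vs"
  then show "prefix (\<tau> us) (\<tau> vs)"
    using assms tau_append unfolding prefix_def by (metis append_in_lists_conv)
next
  assume "prefix (\<tau> us) (\<tau> vs)"
  with assms show "prefix us vs"
  proof (induction us arbitrary: vs rule: lists.induct)
    case Nil
    then show ?case by simp
  next
    case (Cons a us)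
    note a = Cons.hyps
    show ?case
    proof (cases vs)
      \<comment> \<open>The code of \<open>a\<close> contains an end marker, hence is nonempty and
        no prefix of \<open>\<tau> []\<close>.\<close>
      case Nil
      then show ?thesis
        using Cons.prems tau1_eow[OF a(1)] by (auto simp: tau_Nil tau_Cons[OF a])
    next
      case (Cons b vs')
      then have b: "b \<in> W" "vs' \<in> lists W"
        using Cons.prems by auto
      obtain z where z: "\<tau>\<^sub>1 b @ \<tau> vs' = \<tau>\<^sub>1 a @ \<tau> us @ z"
        using Cons.prems Cons by (auto simp: prefix_def tau_Cons[OF a] tau_Cons[OF b])
      then have "a = b"
        using tau1_append_cancel a(1) b(1) by metis
      then show ?thesis
        using z Cons Cons.IH[OF b(2)] by (simp add: prefix_def)
    qed
  qed
qed

lemma seq_prob_extensions_tau: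
  assumes "ws \<in> lists W"
  shows "seq_prob (induced_mass W \<tau> q) (extensions S (\<tau> ws)) = seq_prob q (extensions W ws)"
proof -
  \<comment> \<open>Here \<open>conj_cong\<close> provides \<open>vs \<in> lists W\<close> while the
    second conjunct is rewritten, which \<open>prefix_tau_iff\<close> and
    \<open>tau_in_lists\<close> require.\<close>
  have "{vs \<in> lists W. \<tau> vs \<in> extensions S (\<tau> ws)} = extensions W ws"
    using assms
    by (intro set_eqI)
      (simp add: mem_extensions_iff tau_in_lists prefix_tau_iff del: in_lists_conv_set cong: conj_cong)
  then show ?thesis
    by (simp add: seq_prob_induced_mass[OF inj_on_tau])
qed

end

theorem theorem1:
  fixes W :: "'w set" and C :: "'c set" and S S_eow :: "'s set"
    and orth :: "'w list \<Rightarrow> 'c list" and seg :: "'c list \<Rightarrow> 'w list"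
    and tok :: "'c list \<Rightarrow> 's list" and detok :: "'s list \<Rightarrow> 'c list"
    and \<tau> :: "'w list \<Rightarrow> 's list" and \<delta> :: "'s list \<Rightarrow> 'w list"
    and \<tau>\<^sub>1 :: "'w \<Rightarrow> 's list"
    and p :: "'w list pmf" and ws :: "'w list" and w :: 'w
  assumes "eow_marking_tokeniser W C S orth seg tok detok \<tau> \<delta> \<tau>\<^sub>1 S_eow"
    and "set_pmf p \<subseteq> lists W"
    and "ws \<in> lists W" and "w \<in> W"
  shows
    "seq_prob (pmf p) (extensions W ws)
       = seq_prob (induced_mass W \<tau> (pmf p)) (extensions S (\<tau> ws)) \<and>
     seq_prob (pmf p) (extensions W (ws @ [w]))
       = seq_prob (induced_mass W \<tau> (pmf p)) (extensions S (\<tau> ws @ \<tau>\<^sub>1 w)) \<and>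
     (seq_prob (pmf p) (extensions W ws) \<noteq> 0 \<longrightarrow>
        seq_cond_prob W (pmf p) w ws
          = (\<Prod>t<length (\<tau>\<^sub>1 w).
               seq_cond_prob S (induced_mass W \<tau> (pmf p)) (\<tau>\<^sub>1 w ! t) (\<tau> ws @ take t (\<tau>\<^sub>1 w))))"
proof -
  interpret eow_marking_tokeniser W C S orth seg tok detok \<tau> \<delta> \<tau>\<^sub>1 S_eow
    by (fact assms(1))
  let ?P = "\<lambda>s. seq_prob (induced_mass W \<tau> (pmf p)) (extensions S s)"
  have tau_snoc: "\<tau> (ws @ [w]) = \<tau> ws @ \<tau>\<^sub>1 w"
    using assms(3,4) by (simp add: tau_append tau_singleton)
  have base: "seq_prob (pmf p) (extensions W ws) = ?P (\<tau> ws)"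
    using seq_prob_extensions_tau[OF assms(3)] by simp
  have step: "seq_prob (pmf p) (extensions W (ws @ [w])) = ?P (\<tau> ws @ \<tau>\<^sub>1 w)"
    using seq_prob_extensions_tau[of "ws @ [w]"] assms(3,4) by (simp add: tau_snoc)
  have "seq_cond_prob W (pmf p) w ws
      = (\<Prod>t<length (\<tau>\<^sub>1 w).
           seq_cond_prob S (induced_mass W \<tau> (pmf p)) (\<tau>\<^sub>1 w ! t) (\<tau> ws @ take t (\<tau>\<^sub>1 w)))"
    if "seq_prob (pmf p) (extensions W ws) \<noteq> 0"
  proof -
    \<comment> \<open>Counting from 0, the factor at index \<open>t\<close> is
      \<open>f (Suc t) / f t\<close>.\<close>
    define f where "f t = ?P (\<tau> ws @ take t (\<tau>\<^sub>1 w))" for t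
    have f_Suc: "f (Suc t) = ?P ((\<tau> ws @ take t (\<tau>\<^sub>1 w)) @ [\<tau>\<^sub>1 w ! t])" if "t < length (\<tau>\<^sub>1 w)" for t
      using that by (simp add: f_def take_Suc_conv_app_nth)
    have "f (Suc t) = 0" if "t < length (\<tau>\<^sub>1 w)" "f t = 0" for t
    proof -
      \<comment> \<open>The next code symbol lies in \<open>S\<close>, so the cylinder of the longer
        prefix is contained in that of the shorter one.\<close>
      have "[\<tau>\<^sub>1 w ! t] \<in> lists S"
        using that(1) tau_in_lists[of "[w]"] assms(4) by (auto simp: tau_singleton)
      from seq_prob_induced_mass_eq_0_mono[OF inj_on_tau extensions_append_subset[OF this]
          that(2)[unfolded f_def]]
      show ?thesis
        by (simp only: f_Suc[OF that(1)])
    qed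
    then have "(\<Prod>t<length (\<tau>\<^sub>1 w). f (Suc t) / f t) = f (length (\<tau>\<^sub>1 w)) / f 0"
      using that base by (intro prod_quotients_telescope) (auto simp: f_def)
    \<comment> \<open>The end points \<open>f 0\<close> and
      \<open>f (length (\<tau>\<^sub>1 w))\<close> are the masses that \<open>base\<close> and
      \<open>step\<close> identify with the word-level denominator and numerator.\<close>
    also have "\<dots> = seq_cond_prob W (pmf p) w ws"
      by (simp add: seq_cond_prob_def base step f_def)
    finally show ?thesis
      by (simp add: seq_cond_prob_def f_Suc f_def[symmetric])
  qed
  with base step show ?thesis by simp
qed

end
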